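(* Let $\nu$ be either the Lebesgue measure on $\mathbb R$ or the counting measure on $\mathbb Z$, and let $\pi(t;\gamma)=h(t)\exp(\gamma t-A(\gamma))$ be the density, with respect to $\nu$, of a one-dimensional standard exponential family. For $\theta=(\theta_\ell)\in\mathbb R^L$ let $p(x;\theta)=\prod_{\ell=1}^L\pi(x_\ell;\theta_\ell)$, $x\in\mathbb R^L$, a density with respect to $\mu=\nu^{\otimes L}$. Let $p_r(x)=p(x;\theta_r)$, $r=0,1$, be two such densities with $\theta_0\ne\theta_1$. For $s\in(0,1)$ let $$\theta_{s\ell}=(1-s)\theta_{0\ell}+s\theta_{1\ell},\qquad I_{s\ell}=\big[(1-s)A(\theta_{0\ell})+sA(\theta_{1\ell})\big]-A(\theta_{s\ell}),\qquad I_s=\sum_{\ell=1}^LI_{s\ell},$$ let $T=\{\ell:\theta_{0\ell}\ne\theta_{1\ell}\}$ and, for $\alpha>0$, $$C(\alpha)=\int e^{-\alpha|t|}\,d\nu(t)=\begin{cases}\frac2\alpha&\nu\text{ Lebesgue},\\[2pt]\frac{1+e^{-\alpha}}{1-e^{-\alpha}}\ \Big(\le\frac2{1-e^{-\alpha}}\Big)&\nu\text{ counting}.\end{cases}$$ Consider testing $p_0$ against $p_1$ using the likelihood ratio test based on a single observation, and let $P_{e,r}$ be the probability of error under $p_r$, $r=0,1$. Then $$P_{e,0}+P_{e,1}\ \le\ \inf_{\ell\in T}\ \inf_{s\in(0,1)}\Big[e^{-I_s}\,\|\pi(\cdot\,;\theta_{s\ell})\|_\infty\,C\big(\min(s,1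-s)\,|\theta_{0\ell}-\theta_{1\ell}|\big)\Big].$$
   Context: $\theta_{r\ell}$ denotes the $\ell$-th coordinate of $\theta_r$; the parameters $\theta_{0\ell},\theta_{1\ell}$ belong to the natural parameter space of the family (where $A$ is finite). $\|\cdot\|_\infty$ is the sup norm. The likelihood ratio test (threshold 1) decides $p_1$ when $p_0\le p_1$ and $p_0$ when $p_1<p_0$, so $P_{e,0}=\int p_01\{p_0\le p_1\}d\mu$ and $P_{e,1}=\int p_11\{p_1<p_0\}d\mu$. *)

theory Defs
  imports "HOL-Probability.Probability"
begin

text \<open>
  The base measure is either \<open>lborel\<close> or \<open>count_space \<int>\<close>, both of type \<open>real measure\<close>; in the
  second case the sample space \<open>space \<nu>\<close> is \<open>\<int>\<close>, so \<open>h\<close> only matters there.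
  Vectors with \<open>L\<close> coordinates are functions on a finite type of cardinality \<open>L\<close>.
  Quantities that may be infinite (the sup norm of a density) are \<open>ennreal\<close>-valued.
\<close>

definition log_partition :: "real measure \<Rightarrow> (real \<Rightarrow> real) \<Rightarrow> real \<Rightarrow> real" where
  "log_partition \<nu> h \<gamma> = ln (\<integral>t. h t * exp (\<gamma> * t) \<partial>\<nu>)"

text \<open>
  The parameters at which the logarithm of the partition function is finite, i.e. at which the
  partition function is neither \<open>\<infinity>\<close> nor \<open>0\<close> (the latter occurs only if \<open>h = 0\<close> almost everywhere).
\<close>

definition natural_parameter_space :: "real measure \<Rightarrow> (real \<Rightarrow> real) \<Rightarrow> real set" where
  "natural_parameter_space \<nu> h =
     {\<gamma>. integrable \<nu> (\<lambda>t. h t * exp (\<gamma> * t)) \<and> 0 < (\<integral>t. h t * exp (\<gamma> * t) \<partial>\<nu>)}"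

definition exp_family_density :: "real measure \<Rightarrow> (real \<Rightarrow> real) \<Rightarrow> real \<Rightarrow> real \<Rightarrow> real" where
  "exp_family_density \<nu> h \<gamma> t = h t * exp (\<gamma> * t - log_partition \<nu> h \<gamma>)"

definition product_density ::
    "real measure \<Rightarrow> (real \<Rightarrow> real) \<Rightarrow> ('l::finite \<Rightarrow> real) \<Rightarrow> ('l \<Rightarrow> real) \<Rightarrow> real" where
  "product_density \<nu> h \<theta> x = (\<Prod>l\<in>UNIV. exp_family_density \<nu> h (\<theta> l) (x l))"

definition product_base_measure :: "real measure \<Rightarrow> ('l::finite \<Rightarrow> real) measure" where
  "product_base_measure \<nu> = (\<Pi>\<^sub>M l\<in>UNIV. \<nu>)"

definition interpolate :: "('l \<Rightarrow> real) \<Rightarrow> ('l \<Rightarrow> real) \<Rightarrow> real \<Rightarrow> 'l \<Rightarrow> real" where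
  "interpolate \<theta>0 \<theta>1 s l = (1 - s) * \<theta>0 l + s * \<theta>1 l"

definition chernoff_info_coord ::
    "real measure \<Rightarrow> (real \<Rightarrow> real) \<Rightarrow> ('l \<Rightarrow> real) \<Rightarrow> ('l \<Rightarrow> real) \<Rightarrow> real \<Rightarrow> 'l \<Rightarrow> real" where
  "chernoff_info_coord \<nu> h \<theta>0 \<theta>1 s l =
     ((1 - s) * log_partition \<nu> h (\<theta>0 l) + s * log_partition \<nu> h (\<theta>1 l))
       - log_partition \<nu> h (interpolate \<theta>0 \<theta>1 s l)"

definition chernoff_info ::
    "real measure \<Rightarrow> (real \<Rightarrow> real) \<Rightarrow> ('l::finite \<Rightarrow> real) \<Rightarrow> ('l \<Rightarrow> real) \<Rightarrow> real \<Rightarrow> real" where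
  "chernoff_info \<nu> h \<theta>0 \<theta>1 s = (\<Sum>l\<in>UNIV. chernoff_info_coord \<nu> h \<theta>0 \<theta>1 s l)"

definition sup_norm :: "real measure \<Rightarrow> (real \<Rightarrow> real) \<Rightarrow> ennreal" where
  "sup_norm \<nu> f = (SUP t\<in>space \<nu>. ennreal \<bar>f t\<bar>)"

definition exp_tail_const :: "real measure \<Rightarrow> real \<Rightarrow> ennreal" where
  "exp_tail_const \<nu> \<alpha> = (\<integral>\<^sup>+t. ennreal (exp (- (\<alpha> * \<bar>t\<bar>))) \<partial>\<nu>)"

text \<open>
  The likelihood ratio test with threshold 1; ties are decided in favour of the second density.
\<close>

definition lrt_accepts1 :: "('x \<Rightarrow> real) \<Rightarrow> ('x \<Rightarrow> real) \<Rightarrow> 'x set" where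
  "lrt_accepts1 p0 p1 = {x. p0 x \<le> p1 x}"

definition lrt_error0 :: "'x measure \<Rightarrow> ('x \<Rightarrow> real) \<Rightarrow> ('x \<Rightarrow> real) \<Rightarrow> ennreal" where
  "lrt_error0 \<mu> p0 p1 = (\<integral>\<^sup>+x. ennreal (p0 x) * indicator (lrt_accepts1 p0 p1) x \<partial>\<mu>)"

definition lrt_error1 :: "'x measure \<Rightarrow> ('x \<Rightarrow> real) \<Rightarrow> ('x \<Rightarrow> real) \<Rightarrow> ennreal" where
  "lrt_error1 \<mu> p0 p1 = (\<integral>\<^sup>+x. ennreal (p1 x) * indicator (- lrt_accepts1 p0 p1) x \<partial>\<mu>)"

end

theory Submission
  imports Defs
begin

text \<open>
  The two error probabilities add up to the integral of \<open>min p0 p1\<close>. Write \<open>\<Lambda>\<close> for the log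
  likelihood ratio and \<open>m = min s (1 - s)\<close>. The Chernoff bound \<open>min p0 p1 \<le> p0 powr (1 - s) * p1 powr s\<close>
  loses a factor \<open>exp (s * \<Lambda>)\<close> where \<open>\<Lambda> \<ge> 0\<close> and \<open>exp (- (1 - s) * \<Lambda>)\<close> where \<open>\<Lambda> \<le> 0\<close>, hence at
  least \<open>exp (m * \<bar>\<Lambda>\<bar>)\<close>. In an exponential family the geometric mean of the two densities is
  \<open>exp (- I)\<close> times the density with the interpolated parameter, so that \<open>min p0 p1\<close> is at most
  \<open>exp (- I)\<close> times this density times \<open>exp (- (m * \<bar>\<Lambda>\<bar>))\<close> (\<open>lrt_error_integrand_le\<close>).

  The factor kept here is what gains over the Chernoff bound. \<open>\<Lambda>\<close> is affine in each coordinate, with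
  slope \<open>\<theta>1 l - \<theta>0 l\<close> in coordinate \<open>l\<close>. Integrating this coordinate first, with the interpolated
  density bounded by its sup norm, leaves the integral of \<open>exp (- (\<alpha> * \<bar>t - a\<bar>))\<close> with
  \<open>\<alpha> = m * \<bar>\<theta>1 l - \<theta>0 l\<bar>\<close>, where the centre \<open>a\<close> depends on the other coordinates. The remaining
  coordinates then integrate to one (\<open>lrt_error_sum_le\<close>).

  It remains to bound the integral uniformly in the centre by its value at \<open>0\<close>. For Lebesgue measure
  this is translation invariance. Counting measure is invariant only under integer translations, but
  between consecutive integers the integrand is convex in \<open>a\<close>, so that an integer centre is the worst
  case (\<open>shifted_exp_tail_counting\<close>).
\<close>

section \<open>Densities of a one-dimensional exponential family\<close>

text \<open>
  Convexity of \<open>exp\<close> makes the interpolated integrand at most the interpolation of the integrands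
  at the endpoints. The partition function stays positive because it vanishes at one parameter
  only if \<open>h\<close> vanishes almost everywhere, and then it vanishes at every parameter.
\<close>

lemma interpolate_in_natural_parameter_space:
  assumes h_meas: "h \<in> borel_measurable \<nu>"
    and h_nonneg: "\<And>t. t \<in> space \<nu> \<Longrightarrow> 0 \<le> h t"
    and id_meas: "(\<lambda>t. t) \<in> borel_measurable \<nu>"
    and a: "a \<in> natural_parameter_space \<nu> h" and b: "b \<in> natural_parameter_space \<nu> h"
    and s: "0 \<le> s" "s \<le> 1"
  shows "(1 - s) * a + s * b \<in> natural_parameter_space \<nu> h"
proof -
  note [measurable] = h_meas id_meas
  let ?c = "(1 - s) * a + s * b"
  have ia: "integrable \<nu> (\<lambda>t. h t * exp (a * t))" and ib: "integrable \<nu> (\<lambda>t. h t * exp (b * t))"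
    and pa: "0 < (\<integral>t. h t * exp (a * t) \<partial>\<nu>)"
    using a b by (auto simp: natural_parameter_space_def)
  have ic: "integrable \<nu> (\<lambda>t. h t * exp (?c * t))"
  proof (rule Bochner_Integration.integrable_bound)
    show "integrable \<nu> (\<lambda>t. (1 - s) * (h t * exp (a * t)) + s * (h t * exp (b * t)))"
      using ia ib by auto
    show "AE t in \<nu>. norm (h t * exp (?c * t))
        \<le> norm ((1 - s) * (h t * exp (a * t)) + s * (h t * exp (b * t)))"
    proof (rule AE_I2)
      fix t assume t: "t \<in> space \<nu>"
      have "exp ((1 - s) *\<^sub>R (a * t) + s *\<^sub>R (b * t)) \<le> (1 - s) * exp (a * t) + s * exp (b * t)"
        using convex_onD[OF exp_convex, of s "a * t" "b * t"] s by simp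
      then have "exp (?c * t) \<le> (1 - s) * exp (a * t) + s * exp (b * t)"
        by (simp add: algebra_simps)
      from mult_left_mono[OF this h_nonneg[OF t]]
      have "h t * exp (?c * t) \<le> (1 - s) * (h t * exp (a * t)) + s * (h t * exp (b * t))"
        by (simp add: algebra_simps)
      then show "norm (h t * exp (?c * t))
          \<le> norm ((1 - s) * (h t * exp (a * t)) + s * (h t * exp (b * t)))"
        using h_nonneg[OF t] s by simp
    qed
  qed measurable
  have "(\<integral>t. h t * exp (?c * t) \<partial>\<nu>) \<noteq> 0"
  proof
    assume "(\<integral>t. h t * exp (?c * t) \<partial>\<nu>) = 0"
    then have "AE t in \<nu>. h t * exp (?c * t) = 0"
      by (subst (asm) integral_nonneg_eq_0_iff_AE[OF ic]) (auto intro!: AE_I2 mult_nonneg_nonneg h_nonneg)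
    then have "AE t in \<nu>. h t * exp (a * t) = 0" by simp
    then have "(\<integral>t. h t * exp (a * t) \<partial>\<nu>) = 0" by (rule integral_eq_zero_AE)
    with pa show False by simp
  qed
  moreover have "0 \<le> (\<integral>t. h t * exp (?c * t) \<partial>\<nu>)"
    by (rule integral_nonneg_AE) (auto intro!: AE_I2 mult_nonneg_nonneg h_nonneg)
  ultimately show ?thesis using ic by (auto simp: natural_parameter_space_def)
qed

lemma nn_integral_exp_family_density:
  assumes h_nonneg: "\<And>t. t \<in> space \<nu> \<Longrightarrow> 0 \<le> h t"
    and g: "\<gamma> \<in> natural_parameter_space \<nu> h"
  shows "(\<integral>\<^sup>+t. ennreal (exp_family_density \<nu> h \<gamma> t) \<partial>\<nu>) = 1"
proof -
  let ?Z = "\<integral>t. h t * exp (\<gamma> * t) \<partial>\<nu>"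
  have i: "integrable \<nu> (\<lambda>t. h t * exp (\<gamma> * t))" and p: "0 < ?Z"
    using g by (auto simp: natural_parameter_space_def)
  have eq: "exp_family_density \<nu> h \<gamma> = (\<lambda>t. h t * exp (\<gamma> * t) / ?Z)"
    using p by (auto simp: exp_family_density_def log_partition_def exp_diff fun_eq_iff)
  have "(\<integral>\<^sup>+t. ennreal (exp_family_density \<nu> h \<gamma> t) \<partial>\<nu>) = ennreal (\<integral>t. h t * exp (\<gamma> * t) / ?Z \<partial>\<nu>)"
    unfolding eq using i p h_nonneg
    by (intro nn_integral_eq_integral) (auto intro!: AE_I2)
  also have "(\<integral>t. h t * exp (\<gamma> * t) / ?Z \<partial>\<nu>) = ?Z / ?Z"
    by (rule integral_divide_zero)
  finally show ?thesis using p by simp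
qed

section \<open>The two-sided exponential integral and its translates\<close>

lemma exp_tail_const_lborel:
  assumes "0 < \<alpha>"
  shows "exp_tail_const lborel \<alpha> = ennreal (2 / \<alpha>)"
proof -
  let ?f = "\<lambda>t::real. ennreal (exp (- (\<alpha> * \<bar>t\<bar>)))"
  have half: "(\<integral>\<^sup>+t. ?f t * indicator {0..} t \<partial>lborel) = ennreal (1 / \<alpha>)"
  proof -
    have "(\<integral>\<^sup>+t. ?f t * indicator {0..} t \<partial>lborel)
        = (\<integral>\<^sup>+t. ennreal (exp (- (\<alpha> * t))) * indicator {0..} t \<partial>lborel)"
      by (intro nn_integral_cong) (auto simp: indicator_def)
    also have "\<dots> = ennreal (0 - (- exp (- (\<alpha> * 0)) / \<alpha>))"
    proof (rule nn_integral_FTC_atLeast)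
      show "((\<lambda>t. - exp (- (\<alpha> * t)) / \<alpha>) has_real_derivative exp (- (\<alpha> * t))) (at t)" for t
        using assms by (auto intro!: derivative_eq_intros)
      have "((\<lambda>t. exp (- (\<alpha> * t))) \<longlongrightarrow> 0) at_top"
        using assms by real_asymp
      from tendsto_divide[OF tendsto_minus[OF this] tendsto_const[of \<alpha>]] assms
      show "((\<lambda>t. - exp (- (\<alpha> * t)) / \<alpha>) \<longlongrightarrow> 0) at_top" by simp
    qed auto
    finally show ?thesis by simp
  qed
  have "exp_tail_const lborel \<alpha>
      = (\<integral>\<^sup>+t. ?f t * indicator {0..} t + ?f t * indicator {..<0} t \<partial>lborel)"
    unfolding exp_tail_const_def by (intro nn_integral_cong) (auto simp: indicator_def)
  also have "\<dots> = (\<integral>\<^sup>+t. ?f t * indicator {0..} t \<partial>lborel)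
      + (\<integral>\<^sup>+t. ?f t * indicator {..<0} t \<partial>lborel)"
    by (rule nn_integral_add) auto
  also have "(\<integral>\<^sup>+t. ?f t * indicator {..<0} t \<partial>lborel)
      = (\<integral>\<^sup>+t. ?f t * indicator {0<..} t \<partial>lborel)"
    by (subst nn_integral_real_affine[where c = "-1" and t = 0])
       (auto intro!: nn_integral_cong simp: indicator_def)
  also have "\<dots> = (\<integral>\<^sup>+t. ?f t * indicator {0..} t \<partial>lborel)"
    using AE_lborel_singleton[of "0::real"]
    by (intro nn_integral_cong_AE) (auto elim!: eventually_mono simp: indicator_def)
  finally show ?thesis
    unfolding half using assms by (simp flip: ennreal_plus)
qed

text \<open>
  The non-negative and the negative integers each contribute a geometric series with ratio
  \<open>exp (- \<alpha>)\<close>; the second one starts at \<open>exp (- \<alpha>)\<close> because \<open>0\<close> is counted only once.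
\<close>

lemma exp_tail_const_counting:
  assumes "0 < \<alpha>"
  shows "exp_tail_const (count_space \<int>) \<alpha> = ennreal ((1 + exp (- \<alpha>)) / (1 - exp (- \<alpha>)))"
proof -
  define q where "q = exp (- \<alpha>)"
  have q: "0 < q" "q < 1" using assms by (auto simp: q_def)
  have qn: "exp (- (\<alpha> * real n)) = q ^ n" for n
    by (simp add: q_def exp_of_nat_mult[symmetric] mult.commute)
  let ?f = "\<lambda>t::real. ennreal (exp (- (\<alpha> * \<bar>t\<bar>)))"
  define neg where "neg = (\<lambda>n. - real (Suc n))"
  have bij: "bij_betw real UNIV (range real)" "bij_betw neg UNIV (range neg)"
    by (auto simp: bij_betw_def inj_on_def neg_def)
  have Z: "(\<int> :: real set) = range real \<union> range neg"
  proof -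
    have "of_int k \<in> range real \<union> range neg" for k :: int
    proof (cases "0 \<le> k")
      case True
      then have "of_int k = real (nat k)" by simp
      then show ?thesis by blast
    next
      case False
      then have "of_int k = neg (nat (- k - 1))" by (simp add: neg_def)
      then show ?thesis by blast
    qed
    then show ?thesis by (auto simp: neg_def elim!: Ints_cases)
  qed
  have disj: "range real \<inter> range neg = {}"
    by (auto simp: neg_def)
  have pos_part: "(\<integral>\<^sup>+t. ?f t \<partial>count_space (range real)) = ennreal (1 / (1 - q))"
  proof -
    have "(\<integral>\<^sup>+t. ?f t \<partial>count_space (range real)) = (\<Sum>n. ennreal (q ^ n))"
      by (subst nn_integral_bij_count_space[OF bij(1), symmetric])
         (simp add: nn_integral_count_space_nat qn)
    also have "\<dots> = ennreal (1 / (1 - q))"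
      using q by (subst suminf_ennreal2) (auto simp: suminf_geometric summable_geometric)
    finally show ?thesis .
  qed
  have neg_part: "(\<integral>\<^sup>+t. ?f t \<partial>count_space (range neg)) = ennreal (q / (1 - q))"
  proof -
    have "(\<integral>\<^sup>+t. ?f t \<partial>count_space (range neg)) = (\<Sum>n. ennreal (exp (- (\<alpha> * real (Suc n)))))"
      by (subst nn_integral_bij_count_space[OF bij(2), symmetric])
         (simp add: nn_integral_count_space_nat neg_def add.commute)
    also have "\<dots> = (\<Sum>n. ennreal (q * q ^ n))"
      by (simp only: qn power_Suc)
    also have "\<dots> = ennreal (q / (1 - q))"
      using q by (subst suminf_ennreal2)
        (auto simp: suminf_geometric summable_geometric suminf_mult)
    finally show ?thesis .
  qed
  have "exp_tail_const (count_space \<int>) \<alpha>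
      = (\<integral>\<^sup>+t. ?f t \<partial>count_space (range real)) + (\<integral>\<^sup>+t. ?f t \<partial>count_space (range neg))"
  proof -
    have "exp_tail_const (count_space \<int>) \<alpha>
        = (\<integral>\<^sup>+t. ?f t * indicator (range real) t + ?f t * indicator (range neg) t \<partial>count_space \<int>)"
      unfolding exp_tail_const_def using disj
      by (intro nn_integral_cong) (auto simp: indicator_def Z)
    also have "\<dots> = (\<integral>\<^sup>+t. ?f t * indicator (range real) t \<partial>count_space \<int>)
        + (\<integral>\<^sup>+t. ?f t * indicator (range neg) t \<partial>count_space \<int>)"
      by (rule nn_integral_add) auto
    also have "(\<integral>\<^sup>+t. ?f t * indicator (range real) t \<partial>count_space \<int>)
        = (\<integral>\<^sup>+t. ?f t \<partial>count_space (range real))"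
      by (subst (1 2) nn_integral_count_space_indicator)
         (auto intro!: nn_integral_cong simp: indicator_def Z)
    also have "(\<integral>\<^sup>+t. ?f t * indicator (range neg) t \<partial>count_space \<int>)
        = (\<integral>\<^sup>+t. ?f t \<partial>count_space (range neg))"
      by (subst (1 2) nn_integral_count_space_indicator)
         (auto intro!: nn_integral_cong simp: indicator_def Z)
    finally show ?thesis .
  qed
  also have "\<dots> = ennreal (1 / (1 - q) + q / (1 - q))"
    unfolding pos_part neg_part using q by (simp flip: ennreal_plus)
  finally show ?thesis by (simp add: q_def add_divide_distrib)
qed

lemma shifted_exp_tail_lborel:
  "(\<integral>\<^sup>+t. ennreal (exp (- (\<alpha> * \<bar>t - a\<bar>))) \<partial>lborel) = exp_tail_const lborel \<alpha>"
  unfolding exp_tail_const_def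
  by (subst nn_integral_real_affine[where c = 1 and t = a]) auto

lemma shifted_exp_tail_counting_int:
  assumes "a \<in> \<int>"
  shows "(\<integral>\<^sup>+t. ennreal (exp (- (\<alpha> * \<bar>t - a\<bar>))) \<partial>count_space \<int>) = exp_tail_const (count_space \<int>) \<alpha>"
proof -
  have "bij_betw (\<lambda>t. t - a) \<int> \<int>"
    using assms by (intro bij_betwI[where g = "\<lambda>t. t + a"]) auto
  from nn_integral_bij_count_space[OF this, of "\<lambda>t. ennreal (exp (- (\<alpha> * \<bar>t\<bar>)))"]
  show ?thesis by (simp add: exp_tail_const_def)
qed

text \<open>
  Let \<open>k\<close> be the integer part of \<open>a\<close> and \<open>u\<close> its fractional part. An integer \<open>t\<close> never lies strictly
  between \<open>k\<close> and \<open>k + 1\<close>, so \<open>\<bar>t - a\<bar>\<close> is the interpolation of \<open>\<bar>t - k\<bar>\<close> and \<open>\<bar>t - (k + 1)\<bar>\<close> with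
  weight \<open>u\<close>. Convexity of \<open>exp\<close> then bounds the sum centred at \<open>a\<close> by the same interpolation of the
  sums centred at \<open>k\<close> and \<open>k + 1\<close>, and both of these equal the sum centred at \<open>0\<close>.
\<close>

lemma shifted_exp_tail_counting:
  assumes "0 < \<alpha>"
  shows "(\<integral>\<^sup>+t. ennreal (exp (- (\<alpha> * \<bar>t - a\<bar>))) \<partial>count_space \<int>) \<le> exp_tail_const (count_space \<int>) \<alpha>"
proof -
  define k where "k = (of_int \<lfloor>a\<rfloor> :: real)"
  define u where "u = frac a"
  have u: "0 \<le> u" "u \<le> 1" and a: "a = k + u"
    by (auto simp: u_def k_def frac_def) linarith
  have kZ: "k \<in> \<int>" "k + 1 \<in> \<int>" by (auto simp: k_def)
  let ?g = "\<lambda>b t. ennreal (exp (- (\<alpha> * \<bar>t - b\<bar>)))"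
  have "(\<integral>\<^sup>+t. ?g a t \<partial>count_space \<int>)
      \<le> (\<integral>\<^sup>+t. ennreal (1 - u) * ?g k t + ennreal u * ?g (k + 1) t \<partial>count_space \<int>)"
  proof (rule nn_integral_mono)
    fix t :: real assume "t \<in> space (count_space \<int>)"
    then obtain n where n: "t = of_int n" by (auto elim: Ints_cases)
    have abs_eq: "\<bar>t - a\<bar> = (1 - u) * \<bar>t - k\<bar> + u * \<bar>t - (k + 1)\<bar>"
    proof (cases "n \<le> \<lfloor>a\<rfloor>")
      case True
      then have "t \<le> k" by (simp add: n k_def)
      then show ?thesis using u by (simp add: a abs_if algebra_simps)
    next
      case False
      then have "real_of_int \<lfloor>a\<rfloor> + 1 \<le> real_of_int n" by linarith
      then have "k + 1 \<le> t" by (simp add: n k_def)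
      then show ?thesis using u by (simp add: a abs_if algebra_simps)
    qed
    have "exp (- (\<alpha> * \<bar>t - a\<bar>))
        = exp ((1 - u) *\<^sub>R (- (\<alpha> * \<bar>t - k\<bar>)) + u *\<^sub>R (- (\<alpha> * \<bar>t - (k + 1)\<bar>)))"
      unfolding abs_eq by (simp add: algebra_simps)
    also have "\<dots> \<le> (1 - u) * exp (- (\<alpha> * \<bar>t - k\<bar>)) + u * exp (- (\<alpha> * \<bar>t - (k + 1)\<bar>))"
      using u by (intro convex_onD[OF exp_convex]) auto
    finally show "?g a t \<le> ennreal (1 - u) * ?g k t + ennreal u * ?g (k + 1) t"
      using u by (simp flip: ennreal_mult ennreal_plus add: ennreal_leI)
  qed
  also have "\<dots> = ennreal (1 - u) * exp_tail_const (count_space \<int>) \<alpha>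
      + ennreal u * exp_tail_const (count_space \<int>) \<alpha>"
    using shifted_exp_tail_counting_int[OF kZ(1), of \<alpha>] shifted_exp_tail_counting_int[OF kZ(2), of \<alpha>]
    by (simp add: nn_integral_add nn_integral_cmult)
  also have "\<dots> = (ennreal (1 - u) + ennreal u) * exp_tail_const (count_space \<int>) \<alpha>"
    by (simp add: distrib_right)
  also have "\<dots> = exp_tail_const (count_space \<int>) \<alpha>"
    using u by (simp flip: ennreal_plus)
  finally show ?thesis .
qed

section \<open>The pointwise bound on the smaller density\<close>

text \<open>
  The logarithm of \<open>p1 / p0\<close> wherever this quotient makes sense. The factors \<open>h (x l)\<close> are cancelled,
  so that it is an affine function of \<open>x\<close> also where \<open>h\<close> vanishes.
\<close>

definition log_ratio ::
    "real measure \<Rightarrow> (real \<Rightarrow> real) \<Rightarrow> ('l::finite \<Rightarrow> real) \<Rightarrow> ('l \<Rightarrow> real) \<Rightarrow> ('l \<Rightarrow> real) \<Rightarrow> real" where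
  "log_ratio \<nu> h \<theta>0 \<theta>1 x = (\<Sum>l\<in>UNIV. (\<theta>1 l - \<theta>0 l) * x l
     - (log_partition \<nu> h (\<theta>1 l) - log_partition \<nu> h (\<theta>0 l)))"

text \<open>
  With \<open>H\<close> the product of the \<open>h (x l)\<close> and \<open>E \<theta>\<close> the exponent of the density with parameter \<open>\<theta>\<close>,
  the right-hand side is \<open>H\<close> times the exponential of
  \<open>(1 - s) * E \<theta>0 + s * E \<theta>1 - m * \<bar>E \<theta>1 - E \<theta>0\<bar>\<close>. This exponent is at least the smaller of
  \<open>E \<theta>0\<close> and \<open>E \<theta>1\<close>, because neither weight is below \<open>m\<close>.
\<close>

lemma lrt_error_integrand_le:
  fixes \<nu> :: "real measure" and \<theta>0 \<theta>1 :: "'l::finite \<Rightarrow> real"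
  assumes h_nonneg: "\<And>l. 0 \<le> h (x l)"
    and s: "0 < s" "s < 1"
  defines "p0 \<equiv> product_density \<nu> h \<theta>0" and "p1 \<equiv> product_density \<nu> h \<theta>1"
  shows "ennreal (p0 x) * indicator (lrt_accepts1 p0 p1) x
      + ennreal (p1 x) * indicator (- lrt_accepts1 p0 p1) x
    \<le> ennreal (exp (- chernoff_info \<nu> h \<theta>0 \<theta>1 s))
      * ((\<Prod>k\<in>UNIV. ennreal (exp_family_density \<nu> h (interpolate \<theta>0 \<theta>1 s k) (x k)))
      * ennreal (exp (- (min s (1 - s) * \<bar>log_ratio \<nu> h \<theta>0 \<theta>1 x\<bar>))))"
proof -
  define H where "H = (\<Prod>l\<in>UNIV. h (x l))"
  define E where "E = (\<lambda>\<theta>. \<Sum>l\<in>UNIV. \<theta> l * x l - log_partition \<nu> h (\<theta> l))"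
  define m where "m = min s (1 - s)"
  have H: "0 \<le> H" using h_nonneg by (auto simp: H_def intro!: prod_nonneg)
  have pd: "product_density \<nu> h \<theta> x = H * exp (E \<theta>)" for \<theta>
    by (simp add: product_density_def exp_family_density_def prod.distrib exp_sum H_def E_def)
  have lr: "log_ratio \<nu> h \<theta>0 \<theta>1 x = E \<theta>1 - E \<theta>0"
    by (simp add: log_ratio_def E_def algebra_simps flip: sum_subtractf)
  have Es: "E (interpolate \<theta>0 \<theta>1 s) - chernoff_info \<nu> h \<theta>0 \<theta>1 s = (1 - s) * E \<theta>0 + s * E \<theta>1"
    unfolding E_def chernoff_info_def sum_distrib_left
    by (simp flip: sum_subtractf sum.distrib add: chernoff_info_coord_def interpolate_def)
       (intro sum.cong refl, simp add: algebra_simps)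
  let ?B = "H * exp ((1 - s) * E \<theta>0 + s * E \<theta>1 - m * \<bar>E \<theta>1 - E \<theta>0\<bar>)"
  have rhs: "ennreal (exp (- chernoff_info \<nu> h \<theta>0 \<theta>1 s))
      * ((\<Prod>k\<in>UNIV. ennreal (exp_family_density \<nu> h (interpolate \<theta>0 \<theta>1 s k) (x k)))
      * ennreal (exp (- (m * \<bar>log_ratio \<nu> h \<theta>0 \<theta>1 x\<bar>)))) = ennreal ?B"
  proof -
    have "(\<Prod>k\<in>UNIV. ennreal (exp_family_density \<nu> h (interpolate \<theta>0 \<theta>1 s k) (x k)))
        = ennreal (H * exp (E (interpolate \<theta>0 \<theta>1 s)))"
      using h_nonneg unfolding pd[symmetric] product_density_def
      by (intro prod_ennreal) (auto simp: exp_family_density_def)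
    then show ?thesis
      using H unfolding lr Es[symmetric]
      by (simp flip: ennreal_mult add: exp_add exp_diff exp_minus field_simps)
  qed
  have le0: "H * exp (E \<theta>0) \<le> ?B" if "E \<theta>0 \<le> E \<theta>1"
  proof -
    have "0 \<le> (s - m) * (E \<theta>1 - E \<theta>0)" using that by (simp add: m_def)
    then show ?thesis using that H by (intro mult_left_mono) (auto simp: algebra_simps)
  qed
  have le1: "H * exp (E \<theta>1) \<le> ?B" if "E \<theta>1 \<le> E \<theta>0"
  proof -
    have "0 \<le> (1 - s - m) * (E \<theta>0 - E \<theta>1)" using that by (simp add: m_def)
    then show ?thesis using that H by (intro mult_left_mono) (auto simp: algebra_simps)
  qed
  \<comment> \<open>Comparing densities amounts to comparing exponents only if \<open>H > 0\<close>; otherwise both densities are \<open>0\<close>.\<close>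
  have "H * exp (E \<theta>0) \<le> ?B" if "p0 x \<le> p1 x"
  proof (cases "H = 0")
    case False
    then show ?thesis using that H by (intro le0) (auto simp: p0_def p1_def pd)
  qed simp
  moreover have "H * exp (E \<theta>1) \<le> ?B" if "\<not> p0 x \<le> p1 x"
    using that H mult_left_mono[of "exp (E \<theta>0)" "exp (E \<theta>1)" H]
    by (intro le1) (force simp: p0_def p1_def pd)
  ultimately show ?thesis
    unfolding m_def[symmetric] rhs
    by (cases "p0 x \<le> p1 x")
       (auto simp: lrt_accepts1_def p0_def p1_def pd indicator_def intro!: ennreal_leI)
qed

section \<open>Integrating out one coordinate\<close>

text \<open>
  The substitution \<open>\<bar>d * t + b\<bar> = \<bar>d\<bar> * \<bar>t - (- b / d)\<bar>\<close> moves the offset into the centre of the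
  exponential tail. The bound is therefore uniform in \<open>b\<close>, which carries the other coordinates
  when this is applied in a product space.
\<close>

lemma nn_integral_density_times_exp_tail_le:
  assumes id_meas: "(\<lambda>t. t) \<in> borel_measurable \<nu>"
    and shift: "\<And>\<alpha> a. 0 < \<alpha> \<Longrightarrow> (\<integral>\<^sup>+t. ennreal (exp (- (\<alpha> * \<bar>t - a\<bar>))) \<partial>\<nu>) \<le> exp_tail_const \<nu> \<alpha>"
    and f_nonneg: "\<And>t. t \<in> space \<nu> \<Longrightarrow> 0 \<le> f t"
    and m: "0 < m" and d: "d \<noteq> 0"
  shows "(\<integral>\<^sup>+t. ennreal (f t) * ennreal (exp (- (m * \<bar>d * t + b\<bar>))) \<partial>\<nu>)
    \<le> sup_norm \<nu> f * exp_tail_const \<nu> (m * \<bar>d\<bar>)"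
proof -
  note [measurable] = id_meas
  have eq: "m * \<bar>d * t + b\<bar> = m * \<bar>d\<bar> * \<bar>t - (- b / d)\<bar>" for t
    using d by (simp add: abs_mult[symmetric] field_simps)
  have "(\<integral>\<^sup>+t. ennreal (f t) * ennreal (exp (- (m * \<bar>d * t + b\<bar>))) \<partial>\<nu>)
      \<le> (\<integral>\<^sup>+t. sup_norm \<nu> f * ennreal (exp (- (m * \<bar>d\<bar> * \<bar>t - (- b / d)\<bar>))) \<partial>\<nu>)"
    unfolding eq
  proof (intro nn_integral_mono mult_right_mono)
    fix t assume t: "t \<in> space \<nu>"
    then have "ennreal \<bar>f t\<bar> \<le> sup_norm \<nu> f" unfolding sup_norm_def by (rule SUP_upper)
    then show "ennreal (f t) \<le> sup_norm \<nu> f" using f_nonneg[OF t] by simp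
  qed simp
  also have "\<dots> = sup_norm \<nu> f * (\<integral>\<^sup>+t. ennreal (exp (- (m * \<bar>d\<bar> * \<bar>t - (- b / d)\<bar>))) \<partial>\<nu>)"
    by (intro nn_integral_cmult) measurable
  also have "\<dots> \<le> sup_norm \<nu> f * exp_tail_const \<nu> (m * \<bar>d\<bar>)"
    using m d by (intro mult_left_mono shift) auto
  finally show ?thesis .
qed

text \<open>
  For any sigma-finite base measure for which centring at \<open>0\<close> maximises the exponential tail integral, integrating
  the pointwise bound over coordinate \<open>l\<close> first yields the factor belonging to this coordinate, and
  the interpolated densities of the other coordinates have total mass one.
\<close>

lemma lrt_error_sum_le:
  fixes \<nu> :: "real measure" and \<theta>0 \<theta>1 :: "'l::finite \<Rightarrow> real"
  assumes sf: "sigma_finite_measure \<nu>"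
    and id_meas: "(\<lambda>t. t) \<in> borel_measurable \<nu>"
    and shift: "\<And>\<alpha> a. 0 < \<alpha> \<Longrightarrow> (\<integral>\<^sup>+t. ennreal (exp (- (\<alpha> * \<bar>t - a\<bar>))) \<partial>\<nu>) \<le> exp_tail_const \<nu> \<alpha>"
    and h_meas: "h \<in> borel_measurable \<nu>"
    and h_nonneg: "\<And>t. t \<in> space \<nu> \<Longrightarrow> 0 \<le> h t"
    and theta0: "\<And>l. \<theta>0 l \<in> natural_parameter_space \<nu> h"
    and theta1: "\<And>l. \<theta>1 l \<in> natural_parameter_space \<nu> h"
    and l: "\<theta>0 l \<noteq> \<theta>1 l" and s: "0 < s" "s < 1"
  defines "p0 \<equiv> product_density \<nu> h \<theta>0"
    and "p1 \<equiv> product_density \<nu> h \<theta>1"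
    and "\<mu> \<equiv> product_base_measure \<nu> :: ('l \<Rightarrow> real) measure"
  shows "lrt_error0 \<mu> p0 p1 + lrt_error1 \<mu> p0 p1
    \<le> ennreal (exp (- chernoff_info \<nu> h \<theta>0 \<theta>1 s))
       * sup_norm \<nu> (exp_family_density \<nu> h (interpolate \<theta>0 \<theta>1 s l))
       * exp_tail_const \<nu> (min s (1 - s) * \<bar>\<theta>0 l - \<theta>1 l\<bar>)"
proof -
  interpret sigma_finite_measure \<nu> by (rule sf)
  interpret product_sigma_finite "\<lambda>_::'l. \<nu>" by unfold_locales
  note [measurable] = h_meas
  define \<pi> where "\<pi> = (\<lambda>k. exp_family_density \<nu> h (interpolate \<theta>0 \<theta>1 s k))"
  define m where "m = min s (1 - s)"
  define d where "d = \<theta>1 l - \<theta>0 l"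
  define \<Lambda> where "\<Lambda> = log_ratio \<nu> h \<theta>0 \<theta>1"
  define S where "S = sup_norm \<nu> (\<pi> l) * exp_tail_const \<nu> (m * \<bar>d\<bar>)"
  define c where "c = ennreal (exp (- chernoff_info \<nu> h \<theta>0 \<theta>1 s))"
  let ?I = "UNIV - {l}"
  have m: "0 < m" using s by (simp add: m_def)
  have \<mu>: "\<mu> = (\<Pi>\<^sub>M k\<in>UNIV. \<nu>)" by (simp add: \<mu>_def product_base_measure_def)
  have at_coord: "(\<lambda>x. g (x k)) \<in> borel_measurable (\<Pi>\<^sub>M k\<in>UNIV. \<nu>)"
    if "g \<in> borel_measurable \<nu>" for g :: "real \<Rightarrow> real" and k :: 'l
    using measurable_compose[OF measurable_component_singleton[of k UNIV "\<lambda>_. \<nu>"] that] by simp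
  have \<pi>_meas[measurable]: "\<pi> k \<in> borel_measurable \<nu>" for k
  proof -
    note [measurable] = id_meas
    show ?thesis unfolding \<pi>_def exp_family_density_def by measurable
  qed
  have tail_meas: "(\<lambda>y. ennreal (exp (- (m * \<bar>d * y + b\<bar>)))) \<in> borel_measurable \<nu>" for b
  proof -
    note [measurable] = id_meas
    show ?thesis by measurable
  qed
  note [measurable] = at_coord[OF id_meas] at_coord[OF h_meas] at_coord[OF \<pi>_meas]
  have p_meas[measurable]: "p0 \<in> borel_measurable \<mu>" "p1 \<in> borel_measurable \<mu>"
    unfolding p0_def p1_def product_density_def exp_family_density_def \<mu> by measurable
  have \<Lambda>_meas[measurable]: "\<Lambda> \<in> borel_measurable (\<Pi>\<^sub>M k\<in>UNIV. \<nu>)"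
    unfolding \<Lambda>_def log_ratio_def by measurable
  have \<pi>_nonneg: "0 \<le> \<pi> k t" if "t \<in> space \<nu>" for k t
    using h_nonneg[OF that] by (simp add: \<pi>_def exp_family_density_def)
  have \<pi>_int: "(\<integral>\<^sup>+t. ennreal (\<pi> k t) \<partial>\<nu>) = 1" for k
    unfolding \<pi>_def interpolate_def using s
    by (intro nn_integral_exp_family_density interpolate_in_natural_parameter_space
          h_meas h_nonneg id_meas theta0 theta1) auto
  \<comment> \<open>The acceptance region is a set of arbitrary functions, not of points of \<open>\<mu>\<close>. As a case
    distinction on \<open>p0 x \<le> p1 x\<close>, each integrand is visibly measurable.\<close>
  have branches:
    "(\<lambda>x. ennreal (p0 x) * indicator (lrt_accepts1 p0 p1) x)
      = (\<lambda>x. if p0 x \<le> p1 x then ennreal (p0 x) else 0)"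
    "(\<lambda>x. ennreal (p1 x) * indicator (- lrt_accepts1 p0 p1) x)
      = (\<lambda>x. if p0 x \<le> p1 x then 0 else ennreal (p1 x))"
    by (auto simp: lrt_accepts1_def indicator_def)
  have "lrt_error0 \<mu> p0 p1 + lrt_error1 \<mu> p0 p1
      = (\<integral>\<^sup>+x. ennreal (p0 x) * indicator (lrt_accepts1 p0 p1) x
          + ennreal (p1 x) * indicator (- lrt_accepts1 p0 p1) x \<partial>\<mu>)"
    unfolding lrt_error0_def lrt_error1_def
    by (intro nn_integral_add[symmetric]; unfold branches; measurable)
  also have "\<dots> \<le> (\<integral>\<^sup>+x. c * ((\<Prod>k\<in>UNIV. ennreal (\<pi> k (x k))) * ennreal (exp (- (m * \<bar>\<Lambda> x\<bar>)))) \<partial>\<mu>)"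
  proof (rule nn_integral_mono)
    fix x assume "x \<in> space \<mu>"
    then have "\<And>k. 0 \<le> h (x k)"
      by (intro h_nonneg) (auto simp: \<mu> space_PiM)
    from lrt_error_integrand_le[of h x s \<nu> \<theta>0 \<theta>1, OF this s]
    show "ennreal (p0 x) * indicator (lrt_accepts1 p0 p1) x
          + ennreal (p1 x) * indicator (- lrt_accepts1 p0 p1) x
        \<le> c * ((\<Prod>k\<in>UNIV. ennreal (\<pi> k (x k))) * ennreal (exp (- (m * \<bar>\<Lambda> x\<bar>))))"
      by (simp add: c_def \<pi>_def m_def \<Lambda>_def p0_def p1_def)
  qed
  also have "\<dots> = c * (\<integral>\<^sup>+x. (\<Prod>k\<in>UNIV. ennreal (\<pi> k (x k))) * ennreal (exp (- (m * \<bar>\<Lambda> x\<bar>))) \<partial>\<mu>)"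
    unfolding \<mu> by (intro nn_integral_cmult) measurable
  also have "(\<integral>\<^sup>+x. (\<Prod>k\<in>UNIV. ennreal (\<pi> k (x k))) * ennreal (exp (- (m * \<bar>\<Lambda> x\<bar>))) \<partial>\<mu>)
      = (\<integral>\<^sup>+x. (\<integral>\<^sup>+y. (\<Prod>k\<in>UNIV. ennreal (\<pi> k ((x(l := y)) k)))
            * ennreal (exp (- (m * \<bar>\<Lambda> (x(l := y))\<bar>))) \<partial>\<nu>) \<partial>(\<Pi>\<^sub>M k\<in>?I. \<nu>))"
  proof -
    have U: "(UNIV :: 'l set) = insert l ?I" by auto
    have "(\<lambda>x. (\<Prod>k\<in>UNIV. ennreal (\<pi> k (x k))) * ennreal (exp (- (m * \<bar>\<Lambda> x\<bar>))))
        \<in> borel_measurable (\<Pi>\<^sub>M k\<in>insert l ?I. \<nu>)"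
      unfolding U[symmetric] by measurable
    from product_nn_integral_insert[OF _ _ this]
    show ?thesis unfolding \<mu> U[symmetric] by simp
  qed
  also have "\<dots> \<le> (\<integral>\<^sup>+x. S * (\<Prod>k\<in>?I. ennreal (\<pi> k (x k))) \<partial>(\<Pi>\<^sub>M k\<in>?I. \<nu>))"
  proof (rule nn_integral_mono)
    fix x :: "'l \<Rightarrow> real"
    let ?P = "\<Prod>k\<in>?I. ennreal (\<pi> k (x k))"
    define b where "b = (\<Sum>k\<in>?I. (\<theta>1 k - \<theta>0 k) * x k
        - (log_partition \<nu> h (\<theta>1 k) - log_partition \<nu> h (\<theta>0 k)))
      - (log_partition \<nu> h (\<theta>1 l) - log_partition \<nu> h (\<theta>0 l))"
    have \<Lambda>_upd: "\<Lambda> (x(l := y)) = d * y + b" for y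
      unfolding \<Lambda>_def log_ratio_def b_def d_def by (subst sum.remove[of UNIV l]) auto
    have prod_upd: "(\<Prod>k\<in>UNIV. ennreal (\<pi> k ((x(l := y)) k))) = ennreal (\<pi> l y) * ?P" for y
      by (subst prod.remove[of UNIV l]) auto
    have "(\<integral>\<^sup>+y. (\<Prod>k\<in>UNIV. ennreal (\<pi> k ((x(l := y)) k)))
            * ennreal (exp (- (m * \<bar>\<Lambda> (x(l := y))\<bar>))) \<partial>\<nu>)
        = (\<integral>\<^sup>+y. ?P * (ennreal (\<pi> l y) * ennreal (exp (- (m * \<bar>d * y + b\<bar>)))) \<partial>\<nu>)"
      unfolding \<Lambda>_upd prod_upd by (intro nn_integral_cong) (simp only: mult_ac)
    also have "\<dots> = ?P * (\<integral>\<^sup>+y. ennreal (\<pi> l y) * ennreal (exp (- (m * \<bar>d * y + b\<bar>))) \<partial>\<nu>)"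
      using \<pi>_meas
      by (intro nn_integral_cmult borel_measurable_times_ennreal tail_meas) simp
    also have "\<dots> \<le> ?P * S"
      unfolding S_def using l
      by (intro mult_left_mono nn_integral_density_times_exp_tail_le id_meas shift \<pi>_nonneg m)
         (auto simp: d_def)
    finally show "(\<integral>\<^sup>+y. (\<Prod>k\<in>UNIV. ennreal (\<pi> k ((x(l := y)) k)))
            * ennreal (exp (- (m * \<bar>\<Lambda> (x(l := y))\<bar>))) \<partial>\<nu>) \<le> S * ?P"
      by (simp only: mult.commute)
  qed
  also have "\<dots> = S * (\<integral>\<^sup>+x. (\<Prod>k\<in>?I. ennreal (\<pi> k (x k))) \<partial>(\<Pi>\<^sub>M k\<in>?I. \<nu>))"
    by (intro nn_integral_cmult) measurable
  also have "(\<integral>\<^sup>+x. (\<Prod>k\<in>?I. ennreal (\<pi> k (x k))) \<partial>(\<Pi>\<^sub>M k\<in>?I. \<nu>)) = 1"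
    by (subst product_nn_integral_prod) (auto simp: \<pi>_int)
  finally show ?thesis
    by (simp add: S_def c_def \<pi>_def m_def d_def mult.assoc abs_minus_commute mult_left_mono)
qed

section \<open>The bound for Lebesgue and counting measure\<close>

theorem proposition3:
  fixes \<nu> :: "real measure"
    and h :: "real \<Rightarrow> real"
    and \<theta>0 \<theta>1 :: "'l::finite \<Rightarrow> real"
  assumes nu: "\<nu> = lborel \<or> \<nu> = count_space \<int>"
    and h_measurable: "h \<in> borel_measurable \<nu>"
    and h_nonneg: "\<And>t. t \<in> space \<nu> \<Longrightarrow> 0 \<le> h t"
    and theta0: "\<And>l. \<theta>0 l \<in> natural_parameter_space \<nu> h"
    and theta1: "\<And>l. \<theta>1 l \<in> natural_parameter_space \<nu> h"
    and theta_ne: "\<theta>0 \<noteq> \<theta>1"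
  defines "p0 \<equiv> product_density \<nu> h \<theta>0"
    and "p1 \<equiv> product_density \<nu> h \<theta>1"
    and "\<mu> \<equiv> product_base_measure \<nu> :: ('l \<Rightarrow> real) measure"
    and "T \<equiv> {l. \<theta>0 l \<noteq> \<theta>1 l}"
  shows "(\<forall>\<alpha>>0. \<nu> = lborel \<longrightarrow> exp_tail_const \<nu> \<alpha> = ennreal (2 / \<alpha>)) \<and>
    (\<forall>\<alpha>>0. \<nu> = count_space \<int> \<longrightarrow>
       exp_tail_const \<nu> \<alpha> = ennreal ((1 + exp (- \<alpha>)) / (1 - exp (- \<alpha>))) \<and>
       (1 + exp (- \<alpha>)) / (1 - exp (- \<alpha>)) \<le> 2 / (1 - exp (- \<alpha>))) \<and>
    lrt_error0 \<mu> p0 p1 + lrt_error1 \<mu> p0 p1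
      \<le> (INF l\<in>T. INF s\<in>{0<..<1}.
           ennreal (exp (- chernoff_info \<nu> h \<theta>0 \<theta>1 s))
             * sup_norm \<nu> (exp_family_density \<nu> h (interpolate \<theta>0 \<theta>1 s l))
             * exp_tail_const \<nu> (min s (1 - s) * \<bar>\<theta>0 l - \<theta>1 l\<bar>))"
proof -
  have sf: "sigma_finite_measure \<nu>"
    using nu sigma_finite_measure_count_space_countable[of "\<int> :: real set"]
    by (auto simp: lborel.sigma_finite_measure_axioms countable_int)
  have id_meas: "(\<lambda>t. t) \<in> borel_measurable \<nu>"
    using nu by auto
  have shift: "(\<integral>\<^sup>+t. ennreal (exp (- (\<alpha> * \<bar>t - a\<bar>))) \<partial>\<nu>) \<le> exp_tail_const \<nu> \<alpha>"
    if "0 < \<alpha>" for \<alpha> a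
    using nu shifted_exp_tail_lborel[of \<alpha> a] shifted_exp_tail_counting[OF that, of a] by auto
  have frac_le: "(1 + exp (- \<alpha>)) / (1 - exp (- \<alpha>)) \<le> 2 / (1 - exp (- \<alpha>))"
    if "0 < \<alpha>" for \<alpha> :: real
    using that by (intro divide_right_mono) auto
  have "lrt_error0 \<mu> p0 p1 + lrt_error1 \<mu> p0 p1
      \<le> (INF l\<in>T. INF s\<in>{0<..<1}.
           ennreal (exp (- chernoff_info \<nu> h \<theta>0 \<theta>1 s))
             * sup_norm \<nu> (exp_family_density \<nu> h (interpolate \<theta>0 \<theta>1 s l))
             * exp_tail_const \<nu> (min s (1 - s) * \<bar>\<theta>0 l - \<theta>1 l\<bar>))"
    unfolding \<mu>_def p0_def p1_def
    by (intro INF_greatest lrt_error_sum_le sf id_meas shift h_measurable h_nonneg theta0 theta1)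
       (auto simp: T_def)
  then show ?thesis
    using exp_tail_const_lborel exp_tail_const_counting frac_le by auto
qed

end
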